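(* Let $r\ge 2$ be an integer. Every $r$-graph $H$ satisfies $$\tau^*(H)\le\frac{r+1}{2}\,\nu(H),$$ and equality holds for $H=K^{(r)}_{r+1}$, the complete $r$-graph on $r+1$ vertices.
   Context: For an integer $r\ge 2$, an $r$-graph $H$ is a set of $r$-element subsets, called edges, of a finite vertex set. An $(r-1)$-matching of $H$ is a set of edges of $H$ such that no two distinct edges in it share $r-1$ vertices (i.e. no two distinct members $f,g$ have $|f\cap g|=r-1$). $\nu(H)$ denotes the maximum size of an $(r-1)$-matching of $H$. $\tau^*(H)$ denotes the minimum total weight of an assignment of nonnegative real weights to the $(r-1)$-element subsets of the vertex set such that, for every edge $f$ of $H$, the $(r-1)$-element subsets of $f$ receive total weight at least $1$. The complete $r$-graph $K^{(r)}_{r+1}$ is the $r$-graph consisting of all $r$-element subsets of an $(r+1)$-element vertex set. *)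

theory Defs
  imports "HOL-Analysis.Analysis" "HOL-Library.Ramsey"
begin

(* The Ramsey library's "nsets A k" is the set of k-element subsets of A. *)

definition r_graph :: "nat \<Rightarrow> 'a set \<Rightarrow> 'a set set \<Rightarrow> bool" where
  "r_graph r V H \<longleftrightarrow> finite V \<and> H \<subseteq> nsets V r"

definition matching :: "nat \<Rightarrow> 'a set set \<Rightarrow> 'a set set \<Rightarrow> bool" where
  "matching r H M \<longleftrightarrow> M \<subseteq> H \<and> pairwise (\<lambda>f g. card (f \<inter> g) \<noteq> r - 1) M"

definition nu :: "nat \<Rightarrow> 'a set set \<Rightarrow> nat" where
  "nu r H = Max (card ` {M. matching r H M})"

definition fractional_cover ::
  "nat \<Rightarrow> 'a set \<Rightarrow> 'a set set \<Rightarrow> ('a set \<Rightarrow> real) \<Rightarrow> bool" where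
  "fractional_cover r V H w \<longleftrightarrow>
     (\<forall>e \<in> nsets V (r - 1). 0 \<le> w e) \<and>
     (\<forall>f \<in> H. 1 \<le> sum w (nsets f (r - 1)))"

definition cover_weight :: "nat \<Rightarrow> 'a set \<Rightarrow> ('a set \<Rightarrow> real) \<Rightarrow> real" where
  "cover_weight r V w = sum w (nsets V (r - 1))"

(* The infimum is attained whenever r \<ge> 1 (lemma tau_star_is_min below),
   so it is the minimum of the linear program. *)
definition tau_star :: "nat \<Rightarrow> 'a set \<Rightarrow> 'a set set \<Rightarrow> real" where
  "tau_star r V H = Inf (cover_weight r V ` {w. fractional_cover r V H w})"

lemma nsets_mono_edge:
  assumes "r_graph r V H" "f \<in> H"
  shows "nsets f k \<subseteq> nsets V k"
  using assms by (auto simp: r_graph_def nsets_def)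

lemma nu_is_max:
  assumes "r_graph r V H"
  shows "\<exists>M. matching r H M \<and> card M = nu r H"
    and "matching r H M \<Longrightarrow> card M \<le> nu r H"
proof -
  have "finite H"
    using assms unfolding r_graph_def by (meson finite_imp_finite_nsets finite_subset)
  moreover have "{M. matching r H M} \<subseteq> Pow H"
    by (auto simp: matching_def)
  ultimately have fin: "finite (card ` {M. matching r H M})"
    by (meson finite_Pow_iff finite_imageI finite_subset)
  have "matching r H {}"
    by (simp add: matching_def)
  then have "nu r H \<in> card ` {M. matching r H M}"
    unfolding nu_def using fin by (intro Max_in) auto
  then show "\<exists>M. matching r H M \<and> card M = nu r H" by auto
  show "card M \<le> nu r H" if "matching r H M"
    unfolding nu_def using fin that by (intro Max_ge) auto
qed

lemma cover_weight_attains_min: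
  assumes "r \<ge> 1" and "r_graph r V H"
  shows "\<exists>w. fractional_cover r V H w \<and>
    (\<forall>w'. fractional_cover r V H w' \<longrightarrow> cover_weight r V w \<le> cover_weight r V w')"
proof -
  define K where "K = {w :: 'a set \<Rightarrow> real. \<forall>e. w e \<in> {0..1}}"
  have "K = (\<Pi>\<^sub>E e\<in>UNIV. {0..1})"
    by (auto simp: K_def PiE_def Pi_def)
  then have compK: "compact K"
    using compactin_PiE[of "\<lambda>_. euclidean" UNIV "\<lambda>_::'a set. {0..1::real}"]
    by (simp add: euclidean_product_topology)
  define F where "F = (\<Inter>f\<in>H. {w :: 'a set \<Rightarrow> real. 1 \<le> sum w (nsets f (r - 1))})"
  have cont: "continuous_on UNIV (\<lambda>w :: 'a set \<Rightarrow> real. sum w A)" for A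
    by (intro continuous_on_sum continuous_on_product_coordinates)
  have "closed F"
    unfolding F_def by (intro closed_INT ballI closed_Collect_le cont) simp
  with compK have compFK: "compact (K \<inter> F)" by (rule compact_Int_closed)
  have FK: "fractional_cover r V H w" if "w \<in> K \<inter> F" for w
    using that by (auto simp: fractional_cover_def K_def F_def)
  have "(\<lambda>_. 1) \<in> K \<inter> F"
  proof -
    have "1 \<le> card (nsets f (r - 1))" if "f \<in> H" for f
    proof -
      have f: "finite f" "card f = r"
        using assms that by (auto simp: r_graph_def nsets_def)
      then have "card (nsets f (r - 1)) = r choose (r - 1)"
        by (simp add: card_nsets)
      then show ?thesis by (simp add: Suc_le_eq)
    qed
    then show ?thesis by (auto simp: K_def F_def)
  qed
  moreover have contFK: "continuous_on (K \<inter> F) (cover_weight r V)"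
    unfolding cover_weight_def by (rule continuous_on_subset[OF cont]) simp
  ultimately obtain w where w: "w \<in> K \<inter> F"
    and min: "\<And>w'. w' \<in> K \<inter> F \<Longrightarrow> cover_weight r V w \<le> cover_weight r V w'"
    using continuous_attains_inf[OF compFK, of "cover_weight r V"] contFK by (metis empty_iff)
  have "cover_weight r V w \<le> cover_weight r V u" if u: "fractional_cover r V H u" for u
  proof -
    define u' where "u' = (\<lambda>e. if e \<in> nsets V (r - 1) then min 1 (u e) else 0)"
    have u0: "0 \<le> u e" if "e \<in> nsets V (r - 1)" for e
      using u that by (simp add: fractional_cover_def)
    have "u' \<in> K" using u0 by (auto simp: K_def u'_def)
    moreover have "1 \<le> sum u' (nsets f (r - 1))" if f: "f \<in> H" for f
    proof (cases "\<exists>e\<in>nsets f (r - 1). 1 \<le> u e")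
      case True
      then obtain e where e: "e \<in> nsets f (r - 1)" "1 \<le> u e" by blast
      have "finite f" using assms f by (auto simp: r_graph_def nsets_def)
      then have fin: "finite (nsets f (r - 1))" by (rule finite_imp_finite_nsets)
      have "1 = u' e"
        using e nsets_mono_edge[OF assms(2) f] by (auto simp: u'_def)
      also have "\<dots> \<le> sum u' (nsets f (r - 1))"
        using \<open>u' \<in> K\<close> by (intro member_le_sum e fin) (auto simp: K_def)
      finally show ?thesis .
    next
      case False
      have "sum u' (nsets f (r - 1)) = sum u (nsets f (r - 1))"
        using False nsets_mono_edge[OF assms(2) f]
        by (intro sum.cong) (auto simp: u'_def)
      then show ?thesis using u f by (simp add: fractional_cover_def)
    qed
    ultimately have "u' \<in> K \<inter> F" by (auto simp: F_def)
    then have "cover_weight r V w \<le> cover_weight r V u'" by (rule min)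
    also have "\<dots> \<le> cover_weight r V u"
      unfolding cover_weight_def by (intro sum_mono) (simp add: u'_def)
    finally show ?thesis .
  qed
  with FK[OF w] show ?thesis by blast
qed

lemma tau_star_is_min:
  assumes "r \<ge> 1" and "r_graph r V H"
  shows "\<exists>w. fractional_cover r V H w \<and> cover_weight r V w = tau_star r V H"
    and "fractional_cover r V H w \<Longrightarrow> tau_star r V H \<le> cover_weight r V w"
proof -
  obtain w0 where w0: "fractional_cover r V H w0"
    and min: "\<And>w'. fractional_cover r V H w' \<Longrightarrow> cover_weight r V w0 \<le> cover_weight r V w'"
    using cover_weight_attains_min[OF assms] by blast
  have eq: "tau_star r V H = cover_weight r V w0"
    unfolding tau_star_def using w0 min by (intro cInf_eq_minimum) auto
  show "\<exists>w. fractional_cover r V H w \<and> cover_weight r V w = tau_star r V H"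
    using w0 eq by auto
  show "tau_star r V H \<le> cover_weight r V w" if "fractional_cover r V H w"
    using min[OF that] eq by simp
qed

end

theory Submission
  imports Defs
begin

text \<open>
  Call two edges adjacent if they share \<open>r - 1\<close> vertices, so that a matching is an independent set of
  edges. By linear programming duality the bound on \<open>\<tau>*\<close> amounts to the bound
  \<open>2 x(H) \<le> (r + 1) \<nu>(H)\<close> for every fractional matching \<open>x\<close>, that is, for nonnegative edge weights
  such that the edges through any \<open>(r - 1)\<close>-set have total weight at most \<open>1\<close>.

  Given \<open>x\<close>, choose a maximum matching \<open>M\<close> and, among the maximum matchings, one of largest weight
  \<open>x(M)\<close>. For \<open>f \<in> M\<close>, adding the constraints of the \<open>r\<close> sets of size \<open>r - 1\<close> inside \<open>f\<close> gives
  \<open>r x(f) + x(N f) \<le> r\<close>, where \<open>N f\<close> is the set of edges adjacent to \<open>f\<close>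
  (\<open>neighbourhood_weight\<close>). An edge outside \<open>M\<close> lies in at least one \<open>N f\<close>, since \<open>M\<close> is maximal. If
  every such edge were in two of these sets, summing over \<open>M\<close> would give even \<open>2 x(H) \<le> r |M|\<close>; the
  loss comes from the edges adjacent to exactly one \<open>f \<in> M\<close>, the private neighbours \<open>P f\<close>. The core of
  the proof is the bound \<open>x(P f) \<le> 1 + (r - 2) x(f)\<close> (\<open>private_neighbours_weight\<close>), with which the
  same summation gives the claim (\<open>fractional_matching_le_nu\<close>).

  The edges in \<open>P f\<close> are pairwise adjacent, for otherwise \<open>f\<close> could be exchanged for two of them. So
  they either all contain one \<open>(r - 1)\<close>-subset of \<open>f\<close>, and then \<open>x(f) + x(P f) \<le> 1\<close>, or they all lie in
  \<open>f\<close> plus one further vertex, and then there are at most \<open>r\<close> of them (\<open>clique_of_neighbours\<close>). In the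
  second case \<open>x(g) \<le> x(f)\<close> for each \<open>g \<in> P f\<close>, as otherwise exchanging \<open>f\<close> for \<open>g\<close> would increase
  \<open>x(M)\<close>, and \<open>x(g) + x(f) \<le> 1\<close>; one of the two estimates suffices according to whether
  \<open>x(f) \<le> 1/2\<close>.

  Duality is only needed up to a factor \<open>1 + \<mu>\<close> with \<open>\<mu>\<close> arbitrarily small, and in this form it
  follows from minimising a quadratic penalty function over a compact box
  (\<open>approximate_cover_packing_duality\<close>).

  In the complete graph on \<open>r + 1\<close> vertices all edges are adjacent, so \<open>\<nu> = 1\<close>; and since each
  \<open>(r - 1)\<close>-set lies in exactly two of the \<open>r + 1\<close> edges, every fractional cover weighs at least
  \<open>(r + 1)/2\<close>.
\<close>

section \<open>Approximate duality for covering programs\<close>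

text \<open>
  A one-sided second-order expansion of the penalty \<open>t \<mapsto> max(0, t)\<^sup>2\<close>, whose derivative is
  \<open>2 max(0, t)\<close>; it replaces differentiation below.
\<close>

lemma truncated_square_le:
  fixes t h :: real
  shows "(max 0 (t + h))\<^sup>2 \<le> (max 0 t + h)\<^sup>2"
proof (cases "t + h \<le> 0")
  case False
  then have "0 \<le> max 0 (t + h)" "max 0 (t + h) \<le> max 0 t + h" by auto
  then show ?thesis by (intro power_mono)
qed simp

text \<open>
  The first-order condition at a minimum that may be left only in the direction of positive \<open>h\<close>.
\<close>

lemma quadratic_one_sided_slope:
  fixes a b c :: real
  assumes "b > 0" "c > 0" and "\<And>h. 0 < h \<Longrightarrow> h \<le> b \<Longrightarrow> 0 \<le> 2 * h * a + c * h\<^sup>2"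
  shows "0 \<le> a"
proof (rule ccontr)
  assume "\<not> 0 \<le> a"
  then have a: "a < 0" by simp
  \<comment> \<open>with this step the quadratic term uses up at most half of the negative linear term\<close>
  define h where "h = min b (- a / c)"
  have h: "0 < h" "h \<le> b" "h \<le> - a / c"
    using a assms(1,2) by (auto simp: h_def divide_neg_pos)
  then have "c * h \<le> - a" using assms(2) by (simp add: field_simps)
  then have "h * (c * h) \<le> h * - a" using h(1) by (intro mult_left_mono) auto
  then have "2 * h * a + c * h\<^sup>2 \<le> h * a" by (simp add: power2_eq_square algebra_simps)
  also have "\<dots> < 0" using h(1) a by (simp add: mult_pos_neg)
  finally show False using assms(3)[OF h(1,2)] by simp
qed

text \<open>
  Points \<open>e \<in> E\<close> are covered with weights \<open>w\<close>, sets \<open>N f\<close> are packed with weights \<open>x\<close>. Minimise the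
  convex function \<open>Q(x) = (\<Sum>e. p(e)\<^sup>2) - 2 \<mu> (\<Sum>f. x(f))\<close> over a box, where \<open>p(e)\<close> is the amount by
  which the load on \<open>e\<close> exceeds \<open>1\<close>. At a minimiser, optimality in the direction of \<open>x(f)\<close> says that
  \<open>p\<close> sums to at least \<open>\<mu>\<close> over \<open>N f\<close>, and to exactly \<open>\<mu>\<close> if \<open>x(f) > 0\<close>. Hence \<open>w = p / \<mu>\<close> is a
  cover, and these equalities are the complementary slackness that makes the packing weigh at least as
  much as the cover. They also give \<open>p \<le> \<mu>\<close>, so the packing overloads each point by at most \<open>\<mu>\<close>.
\<close>

lemma approximate_cover_packing_duality:
  fixes H :: "'f set" and E :: "'e set" and N :: "'f \<Rightarrow> 'e set" and \<mu> :: real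
  assumes finH: "finite H" and finE: "finite E"
    and N: "\<And>f. f \<in> H \<Longrightarrow> N f \<subseteq> E" "\<And>f. f \<in> H \<Longrightarrow> N f \<noteq> {}"
    and mu: "0 < \<mu>" "\<mu> \<le> 1"
  obtains x w where "\<And>f. 0 \<le> x f" "\<And>e. e \<in> E \<Longrightarrow> (\<Sum>f | f \<in> H \<and> e \<in> N f. x f) \<le> 1 + \<mu>"
    and "\<And>e. 0 \<le> w e" "\<And>f. f \<in> H \<Longrightarrow> 1 \<le> sum w (N f)"
    and "sum w E \<le> sum x H"
proof -
  define deg where "deg = (\<lambda>x e. \<Sum>f | f \<in> H \<and> e \<in> N f. x f :: real)"
  define p where "p = (\<lambda>x e. max 0 (deg x e - 1))"
  define Q where "Q = (\<lambda>x. (\<Sum>e\<in>E. (p x e)\<^sup>2) - 2 * \<mu> * sum x H)"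
  define K where "K = {x :: 'f \<Rightarrow> real. \<forall>f. x f \<in> {0..2}}"
  have "K = (\<Pi>\<^sub>E f\<in>UNIV. {0..2})"
    by (auto simp: K_def PiE_def Pi_def)
  then have "compact K"
    using compactin_PiE[of "\<lambda>_. euclidean" UNIV "\<lambda>_::'f. {0..2::real}"]
    by (simp add: euclidean_product_topology)
  moreover have "(\<lambda>_. 0) \<in> K" by (simp add: K_def)
  moreover have "continuous_on K Q"
    unfolding Q_def p_def deg_def
    by (intro continuous_intros continuous_on_max
        continuous_on_subset[OF continuous_on_product_coordinates]) auto
  ultimately obtain z where zK: "z \<in> K" and zmin: "\<And>y. y \<in> K \<Longrightarrow> Q z \<le> Q y"
    using continuous_attains_inf[of K Q] by blast
  have z: "0 \<le> z f" "z f \<le> 2" for f using zK by (auto simp: K_def)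
  have p0: "0 \<le> p z e" for e by (simp add: p_def)
  have finN: "finite (N f)" if "f \<in> H" for f
    using N(1)[OF that] finE finite_subset by blast
  have cpos: "real (card (N f)) > 0" if "f \<in> H" for f
    using N(2)[OF that] finN[OF that] by (simp add: card_gt_0_iff)

  \<comment> \<open>compare the minimiser with its perturbation by \<open>h\<close> in the coordinate \<open>f\<close>\<close>
  have step: "0 \<le> 2 * h * (sum (p z) (N f) - \<mu>) + real (card (N f)) * h\<^sup>2"
    if f: "f \<in> H" and h: "0 \<le> z f + h" "z f + h \<le> 2" for f h
  proof -
    define y where "y = z(f := z f + h)"
    have "y \<in> K" using z h by (auto simp: K_def y_def)
    then have Qy: "Q z \<le> Q y" by (rule zmin)
    have upd: "sum y A = sum z A + (if f \<in> A then h else 0)" if "finite A" for A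
    proof -
      have "sum y A = (\<Sum>a\<in>A. z a + (if a = f then h else 0))"
        by (intro sum.cong) (auto simp: y_def)
      then show ?thesis using that by (simp add: sum.distrib sum.delta)
    qed
    have degy: "deg y e = deg z e + (if e \<in> N f then h else 0)" for e
      unfolding deg_def using finH f by (subst upd) auto
    have "(\<Sum>e\<in>E. (p y e)\<^sup>2) \<le> (\<Sum>e\<in>E. (p z e + (if e \<in> N f then h else 0))\<^sup>2)"
    proof (rule sum_mono)
      fix e
      show "(p y e)\<^sup>2 \<le> (p z e + (if e \<in> N f then h else 0))\<^sup>2"
        using truncated_square_le[of "deg z e - 1" "if e \<in> N f then h else 0"]
        unfolding p_def degy by (simp add: algebra_simps)
    qed
    also have "\<dots> = (\<Sum>e\<in>E. (p z e)\<^sup>2 + (if e \<in> N f then 2 * h * p z e + h\<^sup>2 else 0))"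
      by (intro sum.cong) (auto simp: power2_eq_square algebra_simps)
    also have "\<dots> = (\<Sum>e\<in>E. (p z e)\<^sup>2) + (\<Sum>e\<in>N f. 2 * h * p z e + h\<^sup>2)"
      using finE N(1)[OF f] by (simp add: sum.distrib sum.inter_restrict[symmetric] Int_absorb1)
    also have "(\<Sum>e\<in>N f. 2 * h * p z e + h\<^sup>2) = 2 * h * sum (p z) (N f) + real (card (N f)) * h\<^sup>2"
      by (simp add: sum.distrib sum_distrib_left)
    finally show ?thesis
      using Qy upd[OF finH] f unfolding Q_def by (simp add: algebra_simps)
  qed

  have lower: "\<mu> \<le> sum (p z) (N f)" if f: "f \<in> H" for f
  proof (cases "z f < 2")
    case True
    have "0 \<le> sum (p z) (N f) - \<mu>"
    proof (rule quadratic_one_sided_slope[OF _ cpos[OF f]])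
      show "0 < 2 - z f" using True by simp
      fix h assume "0 < h" "h \<le> 2 - z f"
      then show "0 \<le> 2 * h * (sum (p z) (N f) - \<mu>) + real (card (N f)) * h\<^sup>2"
        using z(1)[of f] by (intro step[OF f]) auto
    qed
    then show ?thesis by simp
  next
    case False
    \<comment> \<open>\<open>z f\<close> is at the upper end of the box and cannot be increased, but then each point of \<open>N f\<close> is
      overloaded by \<open>1 \<ge> \<mu>\<close> already\<close>
    obtain e where e: "e \<in> N f" using N(2)[OF f] by blast
    have "2 \<le> z f" using False by simp
    also have "\<dots> \<le> deg z e"
      unfolding deg_def using f e finH z by (intro member_le_sum) auto
    finally have "\<mu> \<le> p z e" using mu by (simp add: p_def)
    also have "\<dots> \<le> sum (p z) (N f)"
      using e finN[OF f] p0 by (intro member_le_sum) auto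
    finally show ?thesis .
  qed

  have upper: "sum (p z) (N f) \<le> \<mu>" if f: "f \<in> H" and zf: "0 < z f" for f
  proof -
    have "0 \<le> \<mu> - sum (p z) (N f)"
    proof (rule quadratic_one_sided_slope[OF zf cpos[OF f]])
      fix h assume "0 < h" "h \<le> z f"
      then show "0 \<le> 2 * h * (\<mu> - sum (p z) (N f)) + real (card (N f)) * h\<^sup>2"
        using step[OF f, of "- h"] z[of f] by (simp add: algebra_simps)
    qed
    then show ?thesis by simp
  qed

  have p_le: "p z e \<le> \<mu>" for e
  proof (cases "p z e = 0")
    case False
    then have "0 < deg z e" by (auto simp: p_def max_def split: if_splits)
    then obtain f where f: "f \<in> H" "e \<in> N f" "0 < z f"
      unfolding deg_def using z by (metis (mono_tags, lifting) sum_pos2 less_le mem_Collect_eq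
          sum.neutral order_less_irrefl)
    have "p z e \<le> sum (p z) (N f)"
      using f finN p0 by (intro member_le_sum) auto
    also have "\<dots> \<le> \<mu>" using upper f by blast
    finally show ?thesis .
  qed (use mu in simp)

  \<comment> \<open>complementary slackness: \<open>p\<close> lives on points of load at least \<open>1\<close>, and \<open>z\<close> on sets over which
    \<open>p\<close> sums to at most \<open>\<mu>\<close>\<close>
  have "sum (p z) E \<le> (\<Sum>e\<in>E. p z e * deg z e)"
  proof (rule sum_mono)
    fix e
    show "p z e \<le> p z e * deg z e"
      by (cases "deg z e \<le> 1") (auto simp: p_def max_def)
  qed
  also have "\<dots> = (\<Sum>e\<in>E. \<Sum>f\<in>H. if e \<in> N f then p z e * z f else 0)"
    unfolding deg_def sum_distrib_left
    using finH by (simp add: sum.inter_filter[symmetric])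
  also have "\<dots> = (\<Sum>f\<in>H. \<Sum>e\<in>E. if e \<in> N f then p z e * z f else 0)"
    by (rule sum.swap)
  also have "\<dots> = (\<Sum>f\<in>H. z f * sum (p z) (N f))"
  proof (rule sum.cong[OF refl])
    fix f assume "f \<in> H"
    then show "(\<Sum>e\<in>E. if e \<in> N f then p z e * z f else 0) = z f * sum (p z) (N f)"
      using finE N(1) by (simp add: sum.inter_restrict[symmetric] Int_absorb1 sum_distrib_left mult.commute)
  qed
  also have "\<dots> \<le> (\<Sum>f\<in>H. z f * \<mu>)"
  proof (rule sum_mono)
    fix f assume "f \<in> H"
    then show "z f * sum (p z) (N f) \<le> z f * \<mu>"
      using upper[of f] z[of f] by (cases "z f = 0") (auto intro: mult_left_mono)
  qed
  also have "\<dots> = \<mu> * sum z H" by (simp add: sum_distrib_left mult.commute)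
  finally have total: "sum (p z) E \<le> \<mu> * sum z H" .

  show thesis
  proof (rule that[of z "\<lambda>e. p z e / \<mu>"])
    show "(\<Sum>f | f \<in> H \<and> e \<in> N f. z f) \<le> 1 + \<mu>" for e
      using p_le[of e] by (simp add: p_def deg_def)
    show "1 \<le> (\<Sum>e\<in>N f. p z e / \<mu>)" if "f \<in> H" for f
      using lower[OF that] mu by (simp add: sum_divide_distrib[symmetric])
    show "(\<Sum>e\<in>E. p z e / \<mu>) \<le> sum z H"
      using total mu by (simp add: sum_divide_distrib[symmetric] field_simps)
  qed (use z p0 mu in auto)
qed

section \<open>Cliques of edges adjacent to a fixed edge\<close>

lemma card_nsets_pred:
  assumes "finite f" "card f = r" "r \<ge> 1"
  shows "card (nsets f (r - 1)) = r"
  using assms binomial_symmetric[of "r - 1" r] by (simp add: card_nsets)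

lemma nsets_pred_nonempty:
  assumes "finite f" "card f = r" "r \<ge> 1"
  shows "nsets f (r - 1) \<noteq> {}"
proof
  assume "nsets f (r - 1) = {}"
  then show False using card_nsets_pred[OF assms] assms(3) by (simp del: card_nsets)
qed

text \<open>
  If \<open>g\<close> and \<open>h\<close> arise from \<open>f\<close> by dropping different vertices, then \<open>f \<inter> g \<inter> h\<close> is too small to
  account for \<open>g \<inter> h\<close>, so \<open>g\<close> and \<open>h\<close> also share their vertex outside \<open>f\<close>.
\<close>

lemma same_new_vertex:
  assumes "r \<ge> 1" and fin: "finite g" "finite h" and "card g = r" "card h = r"
    and fg: "card (f \<inter> g) = r - 1" and fh: "card (f \<inter> h) = r - 1" and gh: "card (g \<inter> h) = r - 1"
    and ne: "f \<inter> g \<noteq> f \<inter> h"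
  shows "g - f = h - f"
proof -
  have one: "card (g - f) = 1" "card (h - f) = 1"
    using assms card_Diff_subset_Int[of g f] card_Diff_subset_Int[of h f]
    by (auto simp: Int_commute)
  have "f \<inter> g \<inter> h \<subset> f \<inter> g"
  proof (rule psubsetI)
    show "f \<inter> g \<inter> h \<noteq> f \<inter> g"
    proof
      assume "f \<inter> g \<inter> h = f \<inter> g"
      then have "f \<inter> g \<subseteq> f \<inter> h" by blast
      then have "f \<inter> g = f \<inter> h" using fin fg fh by (intro card_subset_eq) auto
      with ne show False ..
    qed
  qed blast
  then have "card (f \<inter> g \<inter> h) < card (g \<inter> h)"
    using psubset_card_mono[of "f \<inter> g"] fin fg gh by simp
  then have "g \<inter> h \<noteq> f \<inter> g \<inter> h" by force
  then obtain v where "v \<in> g - f" "v \<in> h - f" by blast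
  with one show ?thesis by (metis card_1_singletonE singletonD)
qed

text \<open>
  The two kinds of cliques in a Johnson graph: all members contain a common \<open>(r - 1)\<close>-set, or all lie
  in a common \<open>(r + 1)\<close>-set. In the second case each member other than \<open>f\<close> is determined by the vertex
  of \<open>f\<close> that it omits, which leaves \<open>r\<close> possibilities.
\<close>

lemma clique_of_neighbours:
  assumes r: "r \<ge> 1" and f: "finite f" "card f = r"
    and P: "\<And>g. g \<in> P \<Longrightarrow> finite g \<and> card g = r \<and> card (f \<inter> g) = r - 1"
    and clique: "\<And>g h. g \<in> P \<Longrightarrow> h \<in> P \<Longrightarrow> g \<noteq> h \<Longrightarrow> card (g \<inter> h) = r - 1"
  shows "(\<exists>e \<in> nsets f (r - 1). \<forall>g \<in> P. e \<subseteq> g) \<or> card P \<le> r"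
proof (cases "\<exists>g1\<in>P. \<exists>g2\<in>P. f \<inter> g1 \<noteq> f \<inter> g2")
  case False
  have ne: "nsets f (r - 1) \<noteq> {}"
    using nsets_pred_nonempty[OF f r] .
  show ?thesis
  proof (cases "P = {}")
    case False
    then obtain g where g: "g \<in> P" by blast
    then have "f \<inter> g \<in> nsets f (r - 1)" using P f by (auto simp: nsets_def)
    moreover have "f \<inter> g \<subseteq> h" if "h \<in> P" for h using \<open>\<not> (\<exists>g1\<in>P. _ g1)\<close> g that by blast
    ultimately show ?thesis by blast
  qed simp
next
  case True
  then obtain g1 g2 where g: "g1 \<in> P" "g2 \<in> P" "f \<inter> g1 \<noteq> f \<inter> g2" by blast
  have new: "a - f = b - f" if "a \<in> P" "b \<in> P" "f \<inter> a \<noteq> f \<inter> b" for a b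
    using that P clique r by (intro same_new_vertex[of r]) auto
  \<comment> \<open>the trace of \<open>a\<close> on \<open>f\<close> differs from that of \<open>g1\<close> or from that of \<open>g2\<close>\<close>
  have all: "a - f = g1 - f" if "a \<in> P" for a
    using new[OF that g(1)] new[OF that g(2)] new[OF g(1,2)] g(3) by metis
  have "inj_on (\<lambda>a. f \<inter> a) P"
  proof (rule inj_onI)
    fix a b assume "a \<in> P" "b \<in> P" "f \<inter> a = f \<inter> b"
    then show "a = b" using all[of a] all[of b] by blast
  qed
  moreover have "(\<lambda>a. f \<inter> a) ` P \<subseteq> nsets f (r - 1)"
    using P f by (auto simp: nsets_def)
  ultimately have "card P \<le> card (nsets f (r - 1))"
    using finite_imp_finite_nsets[OF f(1)] by (rule card_inj_on_le)
  then show ?thesis using card_nsets_pred[OF f r] by simp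
qed

section \<open>Fractional matchings against matchings\<close>

lemma nsets_pred_common:
  assumes "finite f" "finite g" "card f = r" "card g = r" "f \<noteq> g" "r \<ge> 1"
  shows "{e \<in> nsets f (r - 1). e \<subseteq> g} = (if card (f \<inter> g) = r - 1 then {f \<inter> g} else {})"
proof -
  have "f \<inter> g \<subset> f"
    using assms by (metis card_subset_eq inf.cobounded1 inf.cobounded2 psubsetI)
  then have lt: "card (f \<inter> g) < r" using assms psubset_card_mono by metis
  have "card (f \<inter> g) = r - 1 \<and> e = f \<inter> g" if e: "e \<in> nsets f (r - 1)" "e \<subseteq> g" for e
  proof -
    have sub: "e \<subseteq> f \<inter> g" and ce: "card e = r - 1" using e by (auto simp: nsets_def)
    then have "card e \<le> card (f \<inter> g)" using assms by (intro card_mono) auto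
    with lt ce have "card (f \<inter> g) = r - 1" by linarith
    then show ?thesis using sub ce assms card_subset_eq[of "f \<inter> g" e] by auto
  qed
  moreover have "f \<inter> g \<in> nsets f (r - 1)" if "card (f \<inter> g) = r - 1"
    using that assms by (auto simp: nsets_def)
  ultimately show ?thesis by (auto split: if_splits)
qed

lemma r_graph_finite:
  assumes "r_graph r V H"
  shows "finite H"
  using assms unfolding r_graph_def by (meson finite_imp_finite_nsets finite_subset)

lemma r_graph_edge:
  assumes "r_graph r V H" "g \<in> H"
  shows "finite g" "card g = r"
  using assms by (auto simp: r_graph_def nsets_def)

definition neighbours :: "nat \<Rightarrow> 'a set set \<Rightarrow> 'a set \<Rightarrow> 'a set set" where
  "neighbours r H f = {g \<in> H. card (f \<inter> g) = r - 1}"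

text \<open>
  Add up the constraints of the \<open>(r - 1)\<close>-subsets of \<open>f\<close>: the edge \<open>f\<close> occurs in all \<open>r\<close> of them, each
  neighbour \<open>g\<close> in exactly one, that of \<open>f \<inter> g\<close>, and no other edge occurs.
\<close>

lemma neighbourhood_weight:
  assumes r: "r \<ge> 1" and H: "r_graph r V H" and f: "f \<in> H"
    and deg: "\<And>e. e \<in> nsets V (r - 1) \<Longrightarrow> (\<Sum>g | g \<in> H \<and> e \<subseteq> g. x g) \<le> (1 :: real)"
  shows "real r * x f + sum x (neighbours r H f) \<le> real r"
proof -
  have edge: "finite g" "card g = r" if "g \<in> H" for g
    using r_graph_edge[OF H that] by auto
  have finH: "finite H"
    using H by (rule r_graph_finite)
  have fin: "finite (nsets f (r - 1))" using edge[OF f] finite_imp_finite_nsets by blast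
  have term_eq: "(\<Sum>e | e \<in> nsets f (r - 1) \<and> e \<subseteq> g. x g)
      = (if g = f then real r * x f else 0) + (if g \<in> neighbours r H f then x g else 0)"
    if g: "g \<in> H" for g
  proof (cases "g = f")
    case True
    have "{e \<in> nsets f (r - 1). e \<subseteq> f} = nsets f (r - 1)" by (auto simp: nsets_def)
    moreover have "f \<notin> neighbours r H f" using edge[OF f] r by (auto simp: neighbours_def)
    ultimately show ?thesis using True card_nsets_pred edge[OF f] r by auto
  next
    case False
    then have "{e \<in> nsets f (r - 1). e \<subseteq> g} = (if card (f \<inter> g) = r - 1 then {f \<inter> g} else {})"
      using nsets_pred_common[of f g r] edge[OF f] edge[OF g] r by simp
    then show ?thesis using False g by (auto simp: neighbours_def)
  qed
  have "real r * x f + sum x (neighbours r H f)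
      = (\<Sum>g\<in>H. (if g = f then real r * x f else 0) + (if g \<in> neighbours r H f then x g else 0))"
    using finH f by (simp add: sum.distrib sum.inter_filter neighbours_def)
  also have "\<dots> = (\<Sum>g\<in>H. \<Sum>e | e \<in> nsets f (r - 1) \<and> e \<subseteq> g. x g)"
    using term_eq by simp
  also have "\<dots> = (\<Sum>e\<in>nsets f (r - 1). \<Sum>g | g \<in> H \<and> e \<subseteq> g. x g)"
    using finH fin by (rule sum.swap_restrict)
  also have "\<dots> \<le> (\<Sum>e\<in>nsets f (r - 1). 1)"
    using nsets_mono_edge[OF H f] deg by (intro sum_mono) blast
  also have "\<dots> = real r" using card_nsets_pred[OF edge[OF f] r] by simp
  finally show ?thesis .
qed

definition private_neighbours :: "nat \<Rightarrow> 'a set set \<Rightarrow> 'a set set \<Rightarrow> 'a set \<Rightarrow> 'a set set" where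
  "private_neighbours r H M f =
     {g \<in> neighbours r H f. \<forall>f' \<in> M. g \<in> neighbours r H f' \<longrightarrow> f' = f}"

text \<open>
  Private neighbours of \<open>f\<close> have no neighbour in \<open>M\<close> apart from \<open>f\<close>, hence they can take its place.
  Trading \<open>f\<close> for two of them is impossible if \<open>M\<close> is maximum, so they are pairwise adjacent; trading
  \<open>f\<close> for one of them keeps \<open>M\<close> maximum, so none of them outweighs \<open>f\<close> if \<open>M\<close> is heaviest.
\<close>

lemma matching_exchange:
  assumes M: "matching r H M" and A: "matching r H A" "A \<subseteq> private_neighbours r H M f"
  shows "matching r H ((M - {f}) \<union> A)"
proof -
  have cross: "card (a \<inter> m) \<noteq> r - 1" "card (m \<inter> a) \<noteq> r - 1" if "a \<in> A" "m \<in> M - {f}" for a m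
    using that A(2) by (auto simp: private_neighbours_def neighbours_def Int_commute)
  show ?thesis
    using M A(1) cross unfolding matching_def pairwise_def by auto
qed

lemma private_neighbour_notin_matching:
  assumes "matching r H M" "f \<in> M" "g \<in> private_neighbours r H M f"
  shows "g \<notin> M - {f}"
proof
  assume "g \<in> M - {f}"
  then have "card (f \<inter> g) \<noteq> r - 1"
    using assms(1,2) by (auto simp: matching_def pairwise_def)
  then show False using assms(3) by (auto simp: private_neighbours_def neighbours_def)
qed

lemma private_neighbours_clique:
  assumes H: "r_graph r V H" and M: "matching r H M" "card M = nu r H" and f: "f \<in> M"
    and g: "g \<in> private_neighbours r H M f" and h: "h \<in> private_neighbours r H M f" and "g \<noteq> h"
  shows "card (g \<inter> h) = r - 1"
proof (rule ccontr)
  assume nadj: "card (g \<inter> h) \<noteq> r - 1"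
  have finH: "finite H"
    using H by (rule r_graph_finite)
  then have finM: "finite M" using M(1) by (auto simp: matching_def intro: finite_subset)
  have "matching r H {g, h}"
    using nadj g h by (auto simp: matching_def pairwise_def private_neighbours_def neighbours_def Int_commute)
  then have "matching r H ((M - {f}) \<union> {g, h})"
    using g h by (intro matching_exchange[OF M(1)]) auto
  then have le: "card ((M - {f}) \<union> {g, h}) \<le> card M" using nu_is_max(2)[OF H] M(2) by metis
  have "g \<notin> M - {f}" "h \<notin> M - {f}"
    using private_neighbour_notin_matching[OF M(1) f] g h by auto
  then have "card ((M - {f}) \<union> {g, h}) = card (M - {f}) + 2"
    using \<open>g \<noteq> h\<close> finM by (subst card_Un_disjoint) auto
  also have "\<dots> = card M + 1" using f finM card_Suc_Diff1 by fastforce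
  finally show False using le by simp
qed

lemma private_neighbour_weight_le:
  assumes H: "r_graph r V H" and M: "matching r H M" "card M = nu r H" and f: "f \<in> M"
    and best: "\<And>M'. matching r H M' \<Longrightarrow> card M' = nu r H \<Longrightarrow> sum x M' \<le> (sum x M :: real)"
    and g: "g \<in> private_neighbours r H M f"
  shows "x g \<le> x f"
proof -
  have finH: "finite H"
    using H by (rule r_graph_finite)
  then have finM: "finite M" using M(1) by (auto simp: matching_def intro: finite_subset)
  have "matching r H {g}"
    using g by (auto simp: matching_def private_neighbours_def neighbours_def)
  then have M': "matching r H ((M - {f}) \<union> {g})"
    using g by (intro matching_exchange[OF M(1)]) auto
  have "g \<notin> M - {f}" using private_neighbour_notin_matching[OF M(1) f g] .
  then have "card ((M - {f}) \<union> {g}) = Suc (card (M - {f}))"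
    and weight: "sum x ((M - {f}) \<union> {g}) = x g + sum x (M - {f})"
    using finM by simp_all
  then have "card ((M - {f}) \<union> {g}) = card M"
    using card_Suc_Diff1[OF finM f] by simp
  then have "x g + sum x (M - {f}) \<le> sum x M"
    using best[OF M'] M(2) weight by simp
  then show ?thesis using sum.remove[OF finM f, of x] by simp
qed

text \<open>
  The right-hand side is what remains of \<open>(r + 1) - 2 x(f)\<close> when the full bound \<open>r - r x(f)\<close> on the
  weight of all neighbours of \<open>f\<close> is subtracted. In the case of at most \<open>r\<close> private neighbours,
  \<open>r x(f)\<close> and \<open>r (1 - x(f))\<close> are both bounds. They meet in the value \<open>r/2\<close> at \<open>x(f) = 1/2\<close>, where the
  right-hand side has this value too; everywhere else on \<open>[0, 1]\<close> it lies above the smaller of the two.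
\<close>

lemma private_neighbours_weight:
  assumes r: "r \<ge> 2" and H: "r_graph r V H"
    and x: "\<And>g. g \<in> H \<Longrightarrow> 0 \<le> x g"
    and deg: "\<And>e. e \<in> nsets V (r - 1) \<Longrightarrow> (\<Sum>g | g \<in> H \<and> e \<subseteq> g. x g) \<le> (1 :: real)"
    and M: "matching r H M" "card M = nu r H" and f: "f \<in> M"
    and best: "\<And>M'. matching r H M' \<Longrightarrow> card M' = nu r H \<Longrightarrow> sum x M' \<le> sum x M"
  shows "sum x (private_neighbours r H M f) \<le> 1 + (real r - 2) * x f"
proof -
  let ?P = "private_neighbours r H M f"
  have finH: "finite H"
    using H by (rule r_graph_finite)
  have edge: "finite g" "card g = r" if "g \<in> H" for g
    using r_graph_edge[OF H that] by auto
  have fH: "f \<in> H" using f M(1) by (auto simp: matching_def)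
  have PH: "g \<in> H" "card (f \<inter> g) = r - 1" if "g \<in> ?P" for g
    using that by (auto simp: private_neighbours_def neighbours_def)
  have fP: "f \<notin> ?P" using PH(2)[of f] edge[OF fH] r by auto
  have finP: "finite ?P" using PH(1) finH by (meson finite_subset subsetI)
  have star: "x f + sum x A \<le> 1" if e: "e \<in> nsets f (r - 1)" and A: "A \<subseteq> ?P" "\<And>g. g \<in> A \<Longrightarrow> e \<subseteq> g" for e A
  proof -
    have "f \<notin> A" "finite A" using fP A(1) finP finite_subset by blast+
    then have "x f + sum x A = sum x (insert f A)" by simp
    also have "\<dots> \<le> (\<Sum>g | g \<in> H \<and> e \<subseteq> g. x g)"
    proof (rule sum_mono2)
      show "insert f A \<subseteq> {g. g \<in> H \<and> e \<subseteq> g}"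
        using e A PH(1) fH by (auto simp: nsets_def)
    qed (use finH x in auto)
    also have "\<dots> \<le> 1" using deg e nsets_mono_edge[OF H fH] by blast
    finally show ?thesis .
  qed
  have "(\<exists>e \<in> nsets f (r - 1). \<forall>g \<in> ?P. e \<subseteq> g) \<or> card ?P \<le> r"
    using PH edge fH r private_neighbours_clique[OF H M f] by (intro clique_of_neighbours) auto
  then show ?thesis
  proof
    assume "\<exists>e \<in> nsets f (r - 1). \<forall>g \<in> ?P. e \<subseteq> g"
    then have "x f + sum x ?P \<le> 1" using star[of _ ?P] by blast
    moreover have "0 \<le> (real r - 2) * x f" using r x[OF fH] by simp
    ultimately show ?thesis using x[OF fH] by linarith
  next
    assume card: "card ?P \<le> r"
    have bound: "sum x ?P \<le> real r * c" if "\<And>g. g \<in> ?P \<Longrightarrow> x g \<le> c" "0 \<le> c" for c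
    proof -
      have "sum x ?P \<le> real (card ?P) * c" using that(1) by (rule sum_bounded_above)
      also have "\<dots> \<le> real r * c" using card that(2) by (intro mult_right_mono) auto
      finally show ?thesis .
    qed
    have le1: "x g \<le> 1 - x f" if g: "g \<in> ?P" for g
    proof -
      have "f \<inter> g \<in> nsets f (r - 1)" using PH(2)[OF g] edge[OF fH] by (auto simp: nsets_def)
      then show ?thesis using star[of "f \<inter> g" "{g}"] g by auto
    qed
    show ?thesis
    proof (cases "x f \<le> 1 / 2")
      case True
      have "sum x ?P \<le> real r * x f"
        using private_neighbour_weight_le[OF H M f best] x[OF fH] by (intro bound) auto
      then show ?thesis using True by (simp add: algebra_simps)
    next
      case False
      have "x f \<le> 1"
      proof -
        obtain e where "e \<in> nsets f (r - 1)" using nsets_pred_nonempty[of f r] edge[OF fH] r by auto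
        then show ?thesis using star[of e "{}"] by simp
      qed
      then have "sum x ?P \<le> real r * (1 - x f)"
        using le1 by (intro bound) auto
      moreover have "(real r - 1) * 1 \<le> (real r - 1) * (2 * x f)"
        using False r by (intro mult_left_mono) auto
      ultimately show ?thesis by (simp add: algebra_simps)
    qed
  qed
qed

text \<open>
  Count \<open>g \<in> H\<close> once for each \<open>f \<in> M\<close> adjacent to it and once more if it is private, and count the
  members of \<open>M\<close> twice. Then every edge is counted at least twice, while each \<open>f \<in> M\<close> accounts for a
  weight of at most \<open>r + 1\<close>.
\<close>

lemma fractional_matching_le_nu:
  assumes r: "r \<ge> 2" and H: "r_graph r V H"
    and x: "\<And>g. g \<in> H \<Longrightarrow> 0 \<le> x g"
    and deg: "\<And>e. e \<in> nsets V (r - 1) \<Longrightarrow> (\<Sum>g | g \<in> H \<and> e \<subseteq> g. x g) \<le> (1 :: real)"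
  shows "sum x H \<le> (real r + 1) / 2 * real (nu r H)"
proof -
  have finH: "finite H"
    using H by (rule r_graph_finite)
  have edge: "finite g" "card g = r" if "g \<in> H" for g
    using r_graph_edge[OF H that] by auto
  define MM where "MM = {M. matching r H M \<and> card M = nu r H}"
  have "MM \<subseteq> Pow H" by (auto simp: MM_def matching_def)
  then have "finite MM" using finH by (meson finite_Pow_iff finite_subset)
  moreover have "MM \<noteq> {}" using nu_is_max(1)[OF H] by (auto simp: MM_def)
  ultimately have "Max (sum x ` MM) \<in> sum x ` MM" by simp
  then obtain M where "M \<in> MM" and "sum x M = Max (sum x ` MM)" by force
  then have "\<And>M'. M' \<in> MM \<Longrightarrow> sum x M' \<le> sum x M" using \<open>finite MM\<close> by simp
  with \<open>M \<in> MM\<close> have M: "matching r H M" "card M = nu r H"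
    and best: "\<And>M'. matching r H M' \<Longrightarrow> card M' = nu r H \<Longrightarrow> sum x M' \<le> sum x M"
    by (auto simp: MM_def)
  have MH: "M \<subseteq> H" using M(1) by (simp add: matching_def)
  then have finM: "finite M" using finH finite_subset by blast
  let ?N = "neighbours r H" and ?P = "private_neighbours r H M"
  have NH: "?N f \<subseteq> H" "?P f \<subseteq> H" for f by (auto simp: neighbours_def private_neighbours_def)

  have pointwise: "2 * x g \<le> (\<Sum>f\<in>M. (if g \<in> ?N f then x g else 0) + (if g \<in> ?P f then x g else 0))
      + (if g \<in> M then 2 * x g else 0)" if g: "g \<in> H" for g
  proof (cases "g \<in> M")
    case True
    then show ?thesis using x[OF g] by (simp add: sum_nonneg)
  next
    case gM: False
    have "\<exists>f\<in>M. g \<in> ?N f"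
    proof (rule ccontr)
      assume "\<not> (\<exists>f\<in>M. g \<in> ?N f)"
      then have "matching r H (insert g M)"
        using M(1) g by (auto simp: matching_def pairwise_insert neighbours_def Int_commute)
      then have "card (insert g M) \<le> card M" using nu_is_max(2)[OF H] M(2) by metis
      then show False using gM finM by simp
    qed
    then obtain f where f: "f \<in> M" "g \<in> ?N f" by blast
    show ?thesis
    proof (cases "g \<in> ?P f")
      case True
      have "2 * x g = (if g \<in> ?N f then x g else 0) + (if g \<in> ?P f then x g else 0)"
        using f True by simp
      also have "\<dots> \<le> (\<Sum>f\<in>M. (if g \<in> ?N f then x g else 0) + (if g \<in> ?P f then x g else 0))"
        using f(1) finM x[OF g] by (intro member_le_sum) auto
      finally show ?thesis using gM by simp
    next
      case False
      then obtain f' where f': "f' \<in> M" "g \<in> ?N f'" "f' \<noteq> f"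
        using f by (auto simp: private_neighbours_def)
      have "2 * x g = (\<Sum>f\<in>{f, f'}. if g \<in> ?N f then x g else 0)" using f f' by simp
      also have "\<dots> \<le> (\<Sum>f\<in>{f, f'}. (if g \<in> ?N f then x g else 0) + (if g \<in> ?P f then x g else 0))"
        using x[OF g] by (intro sum_mono) auto
      also have "\<dots> \<le> (\<Sum>f\<in>M. (if g \<in> ?N f then x g else 0) + (if g \<in> ?P f then x g else 0))"
        using f f' finM x[OF g] by (intro sum_mono2) auto
      finally show ?thesis using gM by simp
    qed
  qed

  have "2 * sum x H = (\<Sum>g\<in>H. 2 * x g)" by (simp add: sum_distrib_left)
  also have "\<dots> \<le> (\<Sum>g\<in>H. (\<Sum>f\<in>M. (if g \<in> ?N f then x g else 0) + (if g \<in> ?P f then x g else 0))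
      + (if g \<in> M then 2 * x g else 0))"
    by (rule sum_mono) (rule pointwise)
  also have "\<dots> = (\<Sum>f\<in>M. \<Sum>g\<in>H. (if g \<in> ?N f then x g else 0) + (if g \<in> ?P f then x g else 0))
      + (\<Sum>g\<in>H. if g \<in> M then 2 * x g else 0)"
    by (simp only: sum.distrib sum.swap[of _ M H])
  also have "\<dots> = (\<Sum>f\<in>M. sum x (?N f) + sum x (?P f)) + (\<Sum>f\<in>M. 2 * x f)"
    using finH MH NH by (simp add: sum.distrib sum.inter_restrict[symmetric] Int_absorb1)
  also have "\<dots> = (\<Sum>f\<in>M. sum x (?N f) + sum x (?P f) + 2 * x f)"
    by (simp add: sum.distrib)
  also have "\<dots> \<le> (\<Sum>f\<in>M. real r + 1)"
  proof (rule sum_mono)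
    fix f assume f: "f \<in> M"
    then have "f \<in> H" using MH by blast
    then have "real r * x f + sum x (?N f) \<le> real r"
      using r by (intro neighbourhood_weight[OF _ H _ deg]) auto
    moreover have "sum x (?P f) \<le> 1 + (real r - 2) * x f"
      by (rule private_neighbours_weight[OF r H x deg M f best])
    ultimately show "sum x (?N f) + sum x (?P f) + 2 * x f \<le> real r + 1"
      by (simp add: algebra_simps)
  qed
  also have "\<dots> = (real r + 1) * real (nu r H)" using M(2) by simp
  finally show ?thesis by simp
qed

lemma tau_star_le_nu:
  assumes r: "r \<ge> 2" and H: "r_graph r V H"
  shows "tau_star r V H \<le> (real r + 1) / 2 * real (nu r H)"
proof -
  let ?B = "(real r + 1) / 2 * real (nu r H)"
  have finV: "finite V" and finH: "finite H"
    using H r_graph_finite[OF H] by (auto simp: r_graph_def)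
  have edge: "finite g" "card g = r" if "g \<in> H" for g
    using r_graph_edge[OF H that] by auto
  have approx: "tau_star r V H \<le> (1 + \<mu>) * ?B" if mu: "0 < \<mu>" "\<mu> \<le> 1" for \<mu> :: real
  proof -
    have ne: "nsets f (r - 1) \<noteq> {}" if "f \<in> H" for f
      using nsets_pred_nonempty[of f r] edge[OF that] r by simp
    obtain x w where x: "\<And>f. 0 \<le> x f"
      and deg: "\<And>e. e \<in> nsets V (r - 1) \<Longrightarrow> (\<Sum>f | f \<in> H \<and> e \<in> nsets f (r - 1). x f) \<le> 1 + \<mu>"
      and w: "\<And>e. 0 \<le> w e" "\<And>f. f \<in> H \<Longrightarrow> 1 \<le> sum w (nsets f (r - 1))"
      and le: "sum w (nsets V (r - 1)) \<le> sum x H"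
      using approximate_cover_packing_duality[of H "nsets V (r - 1)" "\<lambda>f. nsets f (r - 1)" \<mu>,
          OF finH finite_imp_finite_nsets[OF finV] nsets_mono_edge[OF H] ne mu] by blast
    \<comment> \<open>scaling removes the overload\<close>
    have "(\<Sum>f | f \<in> H \<and> e \<subseteq> f. x f / (1 + \<mu>)) \<le> 1" if e: "e \<in> nsets V (r - 1)" for e
    proof -
      have "{f. f \<in> H \<and> e \<subseteq> f} = {f. f \<in> H \<and> e \<in> nsets f (r - 1)}"
        using e by (auto simp: nsets_def)
      then show ?thesis using deg[OF e] mu by (simp add: sum_divide_distrib[symmetric])
    qed
    then have "(\<Sum>f\<in>H. x f / (1 + \<mu>)) \<le> ?B"
      using x mu by (intro fractional_matching_le_nu[OF r H]) auto
    then have "sum x H \<le> (1 + \<mu>) * ?B"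
      using mu by (simp add: sum_divide_distrib[symmetric] pos_divide_le_eq mult.commute)
    moreover have "tau_star r V H \<le> cover_weight r V w"
      using w r by (intro tau_star_is_min(2)[OF _ H]) (auto simp: fractional_cover_def)
    ultimately show ?thesis using le by (simp add: cover_weight_def)
  qed
  have "((\<lambda>\<mu>. (1 + \<mu>) * ?B) \<longlongrightarrow> (1 + 0) * ?B) (at_right 0)"
    by (intro tendsto_intros)
  moreover have "eventually (\<lambda>\<mu>. tau_star r V H \<le> (1 + \<mu>) * ?B) (at_right 0)"
    using eventually_at_right_real[of 0 1] approx by (auto elim: eventually_mono)
  ultimately have "tau_star r V H \<le> (1 + 0) * ?B"
    by (intro tendsto_lowerbound[of _ _ "at_right (0::real)"]) auto
  then show ?thesis by simp
qed

section \<open>The complete graph on r + 1 vertices\<close>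

lemma nu_complete:
  fixes V :: "'b set"
  assumes r: "r \<ge> 1" and V: "finite V" "card V = r + 1"
  shows "nu r (nsets V r) = 1"
proof -
  have H: "r_graph r V (nsets V r)" using V by (simp add: r_graph_def)
  have adj: "card (f \<inter> g) = r - 1" if "f \<in> nsets V r" "g \<in> nsets V r" "f \<noteq> g" for f g
  proof -
    have fg: "finite f" "finite g" "card f = r" "card g = r" "f \<subseteq> V" "g \<subseteq> V"
      using that by (auto simp: nsets_def)
    have "f \<inter> g \<subset> f"
      using fg that(3) by (metis card_subset_eq inf.cobounded1 inf.cobounded2 psubsetI)
    then have "card (f \<inter> g) < r" using fg psubset_card_mono by metis
    moreover have "card (f \<union> g) \<le> r + 1" using card_mono[of V "f \<union> g"] fg V by simp
    ultimately show ?thesis using card_Un_Int[of f g] fg by linarith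
  qed
  obtain f where f: "f \<in> nsets V r"
    using V card_nsets[of V r] by (metis binomial_eq_0_iff card.empty ex_in_conv not_add_less1)
  then have "matching r (nsets V r) {f}" by (simp add: matching_def)
  then have "1 \<le> nu r (nsets V r)" using nu_is_max(2)[OF H] by fastforce
  moreover obtain M where M: "matching r (nsets V r) M" "card M = nu r (nsets V r)"
    using nu_is_max(1)[OF H] by blast
  then have "\<And>f g. f \<in> M \<Longrightarrow> g \<in> M \<Longrightarrow> f = g"
    using adj by (auto simp: matching_def pairwise_def subset_iff)
  then have "card M \<le> 1" by (metis One_nat_def card_le_Suc0_iff_eq card.infinite le_0_eq nat_le_linear)
  ultimately show ?thesis using M(2) by simp
qed

lemma card_supersets_complete:
  assumes r: "r \<ge> 1" and V: "finite V" "card V = r + 1" and e: "e \<in> nsets V (r - 1)"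
  shows "card {f \<in> nsets V r. e \<subseteq> f} = 2"
proof -
  have e': "e \<subseteq> V" "finite e" "card e = r - 1" using e by (auto simp: nsets_def)
  have "{f \<in> nsets V r. e \<subseteq> f} = (\<lambda>v. insert v e) ` (V - e)"
  proof (intro equalityI subsetI)
    fix f assume f: "f \<in> {f \<in> nsets V r. e \<subseteq> f}"
    then have f': "f \<subseteq> V" "finite f" "card f = r" "e \<subseteq> f" by (auto simp: nsets_def)
    then have "card (f - e) = 1" using e' r by (simp add: card_Diff_subset)
    then obtain v where "f - e = {v}" by (rule card_1_singletonE)
    then have "f = insert v e" "v \<in> V - e" using f' by auto
    then show "f \<in> (\<lambda>v. insert v e) ` (V - e)" by blast
  qed (use e' r in \<open>auto simp: nsets_def\<close>)
  moreover have "inj_on (\<lambda>v. insert v e) (V - e)" by (auto simp: inj_on_def)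
  ultimately show ?thesis using e' V r by (simp add: card_image card_Diff_subset)
qed

text \<open>
  Sum the covering conditions of all \<open>r + 1\<close> edges; each \<open>(r - 1)\<close>-set is counted twice.
\<close>

lemma cover_weight_complete_ge:
  assumes r: "r \<ge> 1" and V: "finite V" "card V = r + 1"
    and w: "fractional_cover r V (nsets V r) w"
  shows "(real r + 1) / 2 \<le> cover_weight r V w"
proof -
  have fin: "finite (nsets V k)" for k using V(1) by (rule finite_imp_finite_nsets)
  have "real r + 1 = (\<Sum>f\<in>nsets V r. 1)"
    using V by (simp add: card_nsets)
  also have "\<dots> \<le> (\<Sum>f\<in>nsets V r. sum w (nsets f (r - 1)))"
    using w by (intro sum_mono) (auto simp: fractional_cover_def)
  also have "\<dots> = (\<Sum>f\<in>nsets V r. \<Sum>e | e \<in> nsets V (r - 1) \<and> e \<subseteq> f. w e)"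
    by (intro sum.cong) (auto simp: nsets_def)
  also have "\<dots> = (\<Sum>e\<in>nsets V (r - 1). \<Sum>f | f \<in> nsets V r \<and> e \<subseteq> f. w e)"
    by (rule sum.swap_restrict[OF fin fin])
  also have "\<dots> = (\<Sum>e\<in>nsets V (r - 1). 2 * w e)"
    using card_supersets_complete[OF r V] by (intro sum.cong) auto
  also have "\<dots> = 2 * cover_weight r V w" by (simp add: cover_weight_def sum_distrib_left)
  finally show ?thesis by simp
qed

theorem theorem1:
  fixes r :: nat
  assumes "r \<ge> 2"
  shows "(\<forall>(V :: 'a set) H. r_graph r V H \<longrightarrow>
            tau_star r V H \<le> (real r + 1) / 2 * real (nu r H))
       \<and> (\<forall>V :: 'b set. finite V \<and> card V = r + 1 \<longrightarrow>
            tau_star r V (nsets V r) = (real r + 1) / 2 * real (nu r (nsets V r)))"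
proof (intro conjI allI impI)
  show "tau_star r V H \<le> (real r + 1) / 2 * real (nu r H)" if "r_graph r V H" for V :: "'a set" and H
    using assms that by (rule tau_star_le_nu)
next
  fix V :: "'b set" assume V: "finite V \<and> card V = r + 1"
  then have H: "r_graph r V (nsets V r)" by (simp add: r_graph_def)
  have r: "r \<ge> 1" using assms by simp
  obtain w where "fractional_cover r V (nsets V r) w" "cover_weight r V w = tau_star r V (nsets V r)"
    using tau_star_is_min(1)[OF r H] by blast
  then have "(real r + 1) / 2 * real (nu r (nsets V r)) \<le> tau_star r V (nsets V r)"
    using cover_weight_complete_ge[of r V w] nu_complete[of r V] r V by simp
  then show "tau_star r V (nsets V r) = (real r + 1) / 2 * real (nu r (nsets V r))"
    using tau_star_le_nu[OF assms H] by simp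
qed

end
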